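(* Consider the hard-thresholding estimator $\hat\theta_H$ with $\eta_n\to0$ and $n^{1/2}\eta_n\to e$, $0\le e<\infty$. Suppose the true parameters $\theta_n\in\mathbb{R}$ satisfy $n^{1/2}\theta_n\to\nu\in\mathbb{R}\cup\{-\infty,\infty\}$. Then $F_{H,n,\theta_n}$ converges weakly to the distribution given by $$\{\Phi(-\nu+e)-\Phi(-\nu-e)\}\,d\delta_{-\nu}(x)+\phi(x)\,\boldsymbol{1}(|x+\nu|>e)\,dx.$$ [This limit reduces to the standard normal distribution in case $|\nu|=\infty$ or $e=0$.]
   Context: For each $n\ge1$ and $\theta\in\mathbb{R}$, $P_{n,\theta}$ is the probability measure under which $y_1,\dots,y_n$ are independent and each $N(\theta,1)$-distributed; $\bar y=n^{-1}\sum_{t=1}^n y_t$. $(\eta_n)$ is a sequence of positive real numbers, and $\hat\theta_H=\bar y\,\boldsymbol{1}(|\bar y|>\eta_n)$, where $\boldsymbol{1}(\cdot)$ is the indicator function. $F_{H,n,\theta}$ denotes the distribution (and its cdf) of $n^{1/2}(\hat\theta_H-\theta)$ under $P_{n,\theta}$. $\Phi$ and $\phi$ are the standard normal cdf and density, $\Phi(-\infty)=0$, $\Phi(\infty)=1$; $\delta_z$ is pointmass at $z$. When $|\nu|=\infty$ the coefficient of the atomic part is $0$, so that part is absent, and $|x+\nu|=\infty$. *)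

theory Defs
  imports "HOL-Probability.Probability"
begin

definition sample_measure :: "nat \<Rightarrow> real \<Rightarrow> (nat \<Rightarrow> real) measure" where
  "sample_measure n \<theta> = PiM {1..n} (\<lambda>_. density lborel (normal_density \<theta> 1))"

definition sample_mean :: "nat \<Rightarrow> (nat \<Rightarrow> real) \<Rightarrow> real" where
  "sample_mean n y = (\<Sum>t=1..n. y t) / real n"

definition hard_threshold :: "nat \<Rightarrow> real \<Rightarrow> (nat \<Rightarrow> real) \<Rightarrow> real" where
  "hard_threshold n \<eta> y = sample_mean n y * of_bool (\<bar>sample_mean n y\<bar> > \<eta>)"

definition F_H :: "real \<Rightarrow> nat \<Rightarrow> real \<Rightarrow> real measure" where
  "F_H \<eta> n \<theta> = distr (sample_measure n \<theta>) borel
     (\<lambda>y. sqrt (real n) * (hard_threshold n \<eta> y - \<theta>))"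

definition Phi :: "ereal \<Rightarrow> real" where
  "Phi z = (if z = - \<infinity> then 0 else if z = \<infinity> then 1
     else cdf std_normal_distribution (real_of_ereal z))"

text \<open>For infinite \<open>\<nu>\<close> the point mass sits at the junk value \<open>real_of_ereal (- \<nu>) = 0\<close>,
  but its coefficient is then 0.\<close>

definition hard_limit :: "ereal \<Rightarrow> real \<Rightarrow> real measure" where
  "hard_limit \<nu> e = measure_of UNIV (sets borel) (\<lambda>A.
     ennreal (Phi (- \<nu> + ereal e) - Phi (- \<nu> - ereal e)) *
       emeasure (return borel (real_of_ereal (- \<nu>))) A +
     emeasure (density lborel
       (\<lambda>x. ennreal (std_normal_density x * of_bool (\<bar>ereal x + \<nu>\<bar> > ereal e)))) A)"

lemma sets_hard_limit [simp, measurable_cong]: "sets (hard_limit \<nu> e) = sets borel"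
  and space_hard_limit [simp]: "space (hard_limit \<nu> e) = UNIV"
  unfolding hard_limit_def using sets.sigma_sets_eq[of "borel :: real measure"] by simp_all

lemma emeasure_hard_limit:
  assumes "A \<in> sets borel"
  shows "emeasure (hard_limit \<nu> e) A =
    ennreal (Phi (- \<nu> + ereal e) - Phi (- \<nu> - ereal e)) *
      indicator A (real_of_ereal (- \<nu>)) +
    (\<integral>\<^sup>+x\<in>A. ennreal (std_normal_density x * of_bool (\<bar>ereal x + \<nu>\<bar> > ereal e)) \<partial>lborel)"
proof -
  let ?c = "ennreal (Phi (- \<nu> + ereal e) - Phi (- \<nu> - ereal e))"
  let ?R = "return borel (real_of_ereal (- \<nu>)) :: real measure"
  let ?D = "density lborel
       (\<lambda>x. ennreal (std_normal_density x * of_bool (\<bar>ereal x + \<nu>\<bar> > ereal e)))"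
  let ?\<mu> = "\<lambda>A. ?c * emeasure ?R A + emeasure ?D A"
  have ca: "countably_additive (sets borel) ?\<mu>"
  proof (rule countably_additiveI)
    fix B :: "nat \<Rightarrow> real set"
    assume B: "range B \<subseteq> sets borel" "disjoint_family B" "(\<Union>i. B i) \<in> sets borel"
    have "(\<Sum>i. ?\<mu> (B i)) = (\<Sum>i. ?c * emeasure ?R (B i)) + (\<Sum>i. emeasure ?D (B i))"
      by (intro suminf_add[symmetric]) auto
    also have "(\<Sum>i. ?c * emeasure ?R (B i)) = ?c * emeasure ?R (\<Union>i. B i)"
      using B by (subst ennreal_suminf_cmult) (subst suminf_emeasure, auto)
    also have "(\<Sum>i. emeasure ?D (B i)) = emeasure ?D (\<Union>i. B i)"
      using B by (intro suminf_emeasure) auto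
    finally show "(\<Sum>i. ?\<mu> (B i)) = ?\<mu> (\<Union>i. B i)" .
  qed
  have "emeasure (hard_limit \<nu> e) A = ?\<mu> A"
    by (rule emeasure_measure_of[OF hard_limit_def])
       (use ca assms in \<open>auto simp: positive_def\<close>)
  also have "\<dots> = ?c * indicator A (real_of_ereal (- \<nu>)) +
    (\<integral>\<^sup>+x\<in>A. ennreal (std_normal_density x * of_bool (\<bar>ereal x + \<nu>\<bar> > ereal e)) \<partial>lborel)"
    using assms by (simp add: emeasure_density)
  finally show ?thesis .
qed

lemma real_distribution_F_H: "real_distribution (F_H \<eta> n \<theta>)"
proof -
  have [measurable]: "sample_mean n \<in> borel_measurable (sample_measure n \<theta>)"
    unfolding sample_mean_def sample_measure_def by measurable
  have p: "prob_space (sample_measure n \<theta>)"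
    unfolding sample_measure_def by (intro prob_space_PiM prob_space_normal_density) simp
  have "(\<lambda>y. sqrt (real n) * (hard_threshold n \<eta> y - \<theta>)) \<in> borel_measurable (sample_measure n \<theta>)"
    unfolding hard_threshold_def of_bool_def by measurable
  then show ?thesis
    unfolding F_H_def using p
    by (simp add: real_distribution_def real_distribution_axioms_def prob_space.prob_space_distr)
qed

lemma real_distribution_hard_limit:
  assumes "0 \<le> e"
  shows "real_distribution (hard_limit \<nu> e)"
proof -
  interpret N: real_distribution std_normal_distribution
    by (rule real_dist_normal_dist)
  let ?I = "\<integral>\<^sup>+x. ennreal (std_normal_density x * of_bool (\<bar>ereal x + \<nu>\<bar> > ereal e)) \<partial>lborel"
  have one: "(\<integral>\<^sup>+x. ennreal (std_normal_density x) \<partial>lborel) = 1"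
    using N.emeasure_space_1 by (simp add: emeasure_density)
  have "ennreal (Phi (- \<nu> + ereal e) - Phi (- \<nu> - ereal e)) + ?I = 1"
  proof (cases \<nu>)
    case (real v)
    let ?K = "{- v - e .. - v + e}"
    have "cdf std_normal_distribution (- v + e) - cdf std_normal_distribution (- v - e)
        = measure std_normal_distribution {- v - e <.. - v + e}"
      using assms by (cases "e = 0") (auto simp: N.cdf_diff_eq)
    then have "ennreal (Phi (- \<nu> + ereal e) - Phi (- \<nu> - ereal e))
        = emeasure std_normal_distribution {- v - e <.. - v + e}"
      by (simp add: real Phi_def N.emeasure_eq_measure)
    also have "\<dots> = (\<integral>\<^sup>+x. ennreal (std_normal_density x) * indicator {- v - e <.. - v + e} x \<partial>lborel)"
      by (simp add: emeasure_density)
    also have "\<dots> = (\<integral>\<^sup>+x. ennreal (std_normal_density x) * indicator ?K x \<partial>lborel)"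
    proof (rule nn_integral_cong_AE)
      have "AE x in lborel. x \<noteq> - v - e" by (rule AE_lborel_singleton)
      then show "AE x in lborel. ennreal (std_normal_density x) * indicator {- v - e <.. - v + e} x
          = ennreal (std_normal_density x) * indicator ?K x"
        by eventually_elim (auto simp: indicator_def)
    qed
    finally have a: "ennreal (Phi (- \<nu> + ereal e) - Phi (- \<nu> - ereal e))
      = (\<integral>\<^sup>+x. ennreal (std_normal_density x) * indicator ?K x \<partial>lborel)" .
    have b: "?I = (\<integral>\<^sup>+x. ennreal (std_normal_density x) * indicator (- ?K) x \<partial>lborel)"
      by (intro nn_integral_cong) (auto simp: real indicator_def)
    have "(\<integral>\<^sup>+x. ennreal (std_normal_density x) * indicator ?K x \<partial>lborel)
        + (\<integral>\<^sup>+x. ennreal (std_normal_density x) * indicator (- ?K) x \<partial>lborel)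
        = (\<integral>\<^sup>+x. ennreal (std_normal_density x) \<partial>lborel)"
      by (subst nn_integral_add[symmetric])
         (auto intro!: nn_integral_cong simp: indicator_def)
    then show ?thesis
      using a b one by simp
  qed (use one in \<open>auto simp: Phi_def\<close>)
  then have "emeasure (hard_limit \<nu> e) UNIV = 1"
    by (simp add: emeasure_hard_limit)
  then show ?thesis
    by (auto simp: real_distribution_def real_distribution_axioms_def intro!: prob_spaceI)
qed

end

theory Submission
  imports Defs
begin

text \<open>With \<open>m\<close> the sample mean, \<open>z = n\<^sup>1\<^sup>/\<^sup>2 (m - \<theta>)\<close> is exactly standard normal, and in terms of it the
  standardised estimator equals \<open>z\<close> if \<open>\<bar>z + v\<bar> > a\<close> and \<open>-v\<close> otherwise, where
  \<open>a = n\<^sup>1\<^sup>/\<^sup>2 \<eta>\<close> and \<open>v = n\<^sup>1\<^sup>/\<^sup>2 \<theta>\<close>. The limit distribution is the image of the standard normal under the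
  same map with \<open>a = e\<close>, \<open>v = \<nu>\<close>. These maps converge at every \<open>z\<close> with \<open>\<bar>z + \<nu>\<bar> \<noteq> e\<close>, i.e.
  almost everywhere, so dominated convergence gives weak convergence.\<close>

text \<open>The shift is extended-real so that one formula covers both the finite-sample maps and
  the limit. For infinite \<open>v\<close> the first branch is always taken, so the default value of
  \<open>real_of_ereal\<close> is never returned.\<close>

definition threshold_map :: "real \<Rightarrow> ereal \<Rightarrow> real \<Rightarrow> real" where
  "threshold_map a v z = (if \<bar>ereal z + v\<bar> > ereal a then z else real_of_ereal (- v))"

lemma measurable_threshold_map [measurable]: "threshold_map a v \<in> borel_measurable borel"
  unfolding threshold_map_def by measurable

text \<open>The coordinates are independent normals, so their sum is normal with mean
  \<open>n * \<theta>\<close> and variance \<open>n\<close>; standardizing the sum gives the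
  claim.\<close>

lemma sample_measure_standardized_mean:
  assumes "n \<ge> 1"
  shows "distr (sample_measure n \<theta>) borel (\<lambda>y. sqrt (real n) * (sample_mean n y - \<theta>))
    = std_normal_distribution"
proof -
  let ?N = "density lborel (normal_density \<theta> 1)"
  let ?M = "sample_measure n \<theta>"
  have N: "prob_space ?N"
    by (rule prob_space_normal_density) simp
  interpret M: prob_space ?M
    unfolding sample_measure_def by (intro prob_space_PiM N)
  have comp: "distr ?M borel (\<lambda>y. y i) = ?N" if "i \<in> {1..n}" for i
  proof -
    have "distr ?M borel (\<lambda>y. y i) = distr ?M ?N (\<lambda>y. y i)"
      by (rule distr_cong) auto
    then show ?thesis
      using distr_PiM_component[of "{1..n}" "\<lambda>_. ?N" i] N that by (simp add: sample_measure_def)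
  qed
  have rv: "(\<lambda>y. y i) \<in> borel_measurable ?M" if "i \<in> {1..n}" for i
    using that unfolding sample_measure_def by measurable
  \<comment> \<open>Independence means that the joint law is the product of the marginals.
    Restriction to \<open>{1..n}\<close> is the identity on the space of the product measure, so the
    joint law is that measure itself.\<close>
  have indep: "M.indep_vars (\<lambda>_. borel) (\<lambda>i y. y i) {1..n}"
  proof (subst M.indep_vars_iff_distr_eq_PiM')
    have "distr ?M (Pi\<^sub>M {1..n} (\<lambda>_. borel)) (\<lambda>y. \<lambda>i\<in>{1..n}. y i)
        = distr ?M ?M (\<lambda>y. y)"
    proof (rule distr_cong)
      show "sets (Pi\<^sub>M {1..n} (\<lambda>_. borel)) = sets ?M"
        unfolding sample_measure_def by (rule sets_PiM_cong) auto
    qed (auto simp: sample_measure_def space_PiM)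
    also have "\<dots> = (\<Pi>\<^sub>M i\<in>{1..n}. distr ?M borel (\<lambda>y. y i))"
      unfolding distr_id by (subst sample_measure_def, rule PiM_cong) (simp_all add: comp)
    finally show "distr ?M (Pi\<^sub>M {1..n} (\<lambda>_. borel)) (\<lambda>y. \<lambda>i\<in>{1..n}. y i)
        = (\<Pi>\<^sub>M i\<in>{1..n}. distr ?M borel (\<lambda>y. y i))" .
  qed (use assms rv in auto)
  have "distributed ?M lborel (\<lambda>y. \<Sum>t\<in>{1..n}. y t)
      (normal_density (\<Sum>t\<in>{1..n}. \<theta>) (sqrt (\<Sum>t\<in>{1..n}. 1\<^sup>2)))"
    using assms indep comp rv
    by (intro M.sum_indep_normal) (auto simp: distributed_def cong: distr_cong)
  then have "distributed ?M lborel (\<lambda>y. ((\<Sum>t\<in>{1..n}. y t) - real n * \<theta>) / sqrt (real n))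
      std_normal_density"
    using assms by (subst (asm) M.normal_standard_normal_convert) auto
  moreover have "((\<Sum>t\<in>{1..n}. y t) - real n * \<theta>) / sqrt (real n)
      = sqrt (real n) * (sample_mean n y - \<theta>)" for y
    using assms real_sqrt_mult_self[of "real n"]
    by (simp add: sample_mean_def field_simps del: real_sqrt_mult_self)
  ultimately show ?thesis
    by (simp add: distributed_def cong: distr_cong)
qed

text \<open>Scaling by the positive \<open>sqrt n\<close> preserves the threshold comparison, and
  where the estimator is 0 the standardized error is \<open>- sqrt n * \<theta>\<close>.\<close>

lemma F_H_eq_distr_threshold_map:
  assumes "n \<ge> 1"
  shows "F_H \<eta> n \<theta> = distr std_normal_distribution borel
    (threshold_map (sqrt (real n) * \<eta>) (ereal (sqrt (real n) * \<theta>)))"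
proof -
  have [measurable]: "sample_mean n \<in> borel_measurable (sample_measure n \<theta>)"
    unfolding sample_mean_def sample_measure_def by measurable
  let ?s = "sqrt (real n)"
  have s: "?s > 0" using assms by simp
  have "?s * (hard_threshold n \<eta> y - \<theta>)
      = threshold_map (?s * \<eta>) (ereal (?s * \<theta>)) (?s * (sample_mean n y - \<theta>))" for y
  proof -
    have "\<bar>?s * (sample_mean n y - \<theta>) + ?s * \<theta>\<bar> = ?s * \<bar>sample_mean n y\<bar>"
      using s by (simp add: abs_mult flip: distrib_left)
    then show ?thesis
      using s by (simp add: threshold_map_def hard_threshold_def)
  qed
  then have "F_H \<eta> n \<theta> = distr (sample_measure n \<theta>) borel
      (threshold_map (?s * \<eta>) (ereal (?s * \<theta>)) \<circ> (\<lambda>y. ?s * (sample_mean n y - \<theta>)))"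
    by (simp add: F_H_def comp_def)
  also have "\<dots> = distr (distr (sample_measure n \<theta>) borel (\<lambda>y. ?s * (sample_mean n y - \<theta>))) borel
      (threshold_map (?s * \<eta>) (ereal (?s * \<theta>)))"
    by (rule distr_distr[symmetric]) measurable
  finally show ?thesis
    using assms by (simp add: sample_measure_standardized_mean)
qed

text \<open>The map fixes every point of \<open>?U\<close>, which leaves the normal density there,
  and sends the rest to one point, which produces the atom.\<close>

lemma hard_limit_eq_distr_threshold_map:
  assumes "0 \<le> e"
  shows "hard_limit \<nu> e = distr std_normal_distribution borel (threshold_map e \<nu>)"
proof (rule measure_eqI)
  fix A assume "A \<in> sets (hard_limit \<nu> e)"
  then have A [measurable]: "A \<in> sets borel" by simp
  interpret N: real_distribution std_normal_distribution by (rule real_dist_normal_dist)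
  interpret L: real_distribution "hard_limit \<nu> e"
    using assms by (rule real_distribution_hard_limit)
  let ?c = "ennreal (Phi (- \<nu> + ereal e) - Phi (- \<nu> - ereal e))"
  let ?U = "{z. \<bar>ereal z + \<nu>\<bar> > ereal e}"
  have U [measurable]: "?U \<in> sets borel" by measurable
  have dens: "(\<integral>\<^sup>+x\<in>B. ennreal (std_normal_density x * of_bool (\<bar>ereal x + \<nu>\<bar> > ereal e)) \<partial>lborel)
      = emeasure std_normal_distribution (B \<inter> ?U)" if [measurable]: "B \<in> sets borel" for B
    by (subst emeasure_density) (auto intro!: nn_integral_cong simp: indicator_def)
  \<comment> \<open>The atom's weight needs no computation with \<open>Phi\<close>: both
    \<open>?c\<close> and the mass of \<open>- ?U\<close> complete the finite mass of
    \<open>?U\<close> to 1, so they agree by cancellation.\<close>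
  have "?c + emeasure std_normal_distribution ?U = 1"
    using L.emeasure_space_1 dens[of UNIV] by (simp add: emeasure_hard_limit)
  moreover have "emeasure std_normal_distribution (- ?U) + emeasure std_normal_distribution ?U
      = emeasure std_normal_distribution UNIV"
    by (subst plus_emeasure) auto
  ultimately have "?c + emeasure std_normal_distribution ?U
      = emeasure std_normal_distribution (- ?U) + emeasure std_normal_distribution ?U"
    using N.emeasure_space_1 by simp
  then have c: "?c = emeasure std_normal_distribution (- ?U)"
    using N.emeasure_finite[of ?U]
    by (subst (asm) (1 2) add.commute) (simp only: ennreal_add_left_cancel infinity_ennreal_def, blast)
  have "threshold_map e \<nu> -` A = (A \<inter> ?U) \<union> (if real_of_ereal (- \<nu>) \<in> A then - ?U else {})"
    by (auto simp: threshold_map_def split: if_splits)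
  then have "emeasure (distr std_normal_distribution borel (threshold_map e \<nu>)) A
      = emeasure std_normal_distribution
          ((A \<inter> ?U) \<union> (if real_of_ereal (- \<nu>) \<in> A then - ?U else {}))"
    by (simp add: emeasure_distr)
  also have "\<dots> = ?c * indicator A (real_of_ereal (- \<nu>))
      + emeasure std_normal_distribution (A \<inter> ?U)"
    unfolding c by (subst plus_emeasure[symmetric]) (auto simp: add.commute)
  finally show "emeasure (hard_limit \<nu> e) A
      = emeasure (distr std_normal_distribution borel (threshold_map e \<nu>)) A"
    by (simp add: emeasure_hard_limit dens)
qed simp

lemma eventually_less_of_tendsto:
  fixes f g :: "'a \<Rightarrow> 'b :: {dense_order, linorder_topology}"
  assumes f: "(f \<longlongrightarrow> l) F" and g: "(g \<longlongrightarrow> m) F" and less: "l < m"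
  shows "\<forall>\<^sub>F x in F. f x < g x"
proof -
  obtain b where "l < b" "b < m" using dense[OF less] by auto
  then have "\<forall>\<^sub>F x in F. f x < b" "\<forall>\<^sub>F x in F. b < g x"
    using order_tendstoD[OF f] order_tendstoD[OF g] by auto
  then show ?thesis by eventually_elim (rule less_trans)
qed

text \<open>Off the boundary the comparison is strict in the limit, hence eventually settled the
  same way along the sequence: the values are then constantly \<open>z\<close>, or equal to
  \<open>- v n\<close>.\<close>

lemma tendsto_threshold_map:
  assumes a: "a \<longlonglongrightarrow> e" and v: "(\<lambda>n. ereal (v n)) \<longlonglongrightarrow> \<nu>"
    and z: "\<bar>ereal z + \<nu>\<bar> \<noteq> ereal e"
  shows "(\<lambda>n. threshold_map (a n) (ereal (v n)) z) \<longlonglongrightarrow> threshold_map e \<nu> z"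
proof -
  have a': "(\<lambda>n. ereal (a n)) \<longlonglongrightarrow> ereal e" using a by simp
  have abs: "(\<lambda>n. \<bar>ereal z + ereal (v n)\<bar>) \<longlonglongrightarrow> \<bar>ereal z + \<nu>\<bar>"
    by (intro tendsto_abs_ereal tendsto_add_ereal_general v tendsto_const) simp
  consider "\<bar>ereal z + \<nu>\<bar> > ereal e" | "\<bar>ereal z + \<nu>\<bar> < ereal e"
    using z by force
  then show ?thesis
  proof cases
    case 1
    have "\<forall>\<^sub>F n in sequentially. ereal (a n) < \<bar>ereal z + ereal (v n)\<bar>"
      using eventually_less_of_tendsto[OF a' abs 1] by simp
   then have "\<forall>\<^sub>F n in sequentially. threshold_map (a n) (ereal (v n)) z = threshold_map e \<nu> z"
      by eventually_elim (use 1 in \<open>simp add: threshold_map_def\<close>)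
    then show ?thesis by (rule tendsto_eventually)
  next
    case 2
    \<comment> \<open>An infinite \<open>\<nu>\<close> would make the left side of the inequality
      infinite.\<close>
    then obtain r where r: "\<nu> = ereal r" by (cases \<nu>) auto
    have "\<forall>\<^sub>F n in sequentially. \<bar>ereal z + ereal (v n)\<bar> < ereal (a n)"
      using eventually_less_of_tendsto[OF abs a' 2] by simp
   then have "\<forall>\<^sub>F n in sequentially. - v n = threshold_map (a n) (ereal (v n)) z"
      by eventually_elim (simp add: threshold_map_def)
    moreover have "(\<lambda>n. - v n) \<longlonglongrightarrow> - r"
      using v by (intro tendsto_minus) (simp add: r)
    ultimately have "(\<lambda>n. threshold_map (a n) (ereal (v n)) z) \<longlonglongrightarrow> - r"
      by (rule Lim_transform_eventually[rotated])
    then show ?thesis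
      using 2 by (simp add: threshold_map_def r)
  qed
qed

text \<open>For finite \<open>\<nu>\<close> the boundary has at most two points, a null set for any
  law with a density; for infinite \<open>\<nu>\<close> it is empty.\<close>

lemma AE_threshold_boundary:
  "AE z in std_normal_distribution. \<bar>ereal z + \<nu>\<bar> \<noteq> ereal e"
proof -
  have "AE z in lborel. \<bar>ereal z + \<nu>\<bar> \<noteq> ereal e"
  proof (cases \<nu>)
    case (real r)
    have "AE z in lborel. z \<noteq> e - r" "AE z in lborel. z \<noteq> - e - r"
      by (rule AE_lborel_singleton)+
    then show ?thesis
      by eventually_elim (auto simp: real abs_if split: if_splits)
  qed auto
  then show ?thesis by (subst AE_density) auto
qed

theorem theorem4:
  fixes \<eta> :: "nat \<Rightarrow> real" and \<theta> :: "nat \<Rightarrow> real" and e :: real and \<nu> :: ereal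
  assumes "\<And>n. n \<ge> 1 \<Longrightarrow> \<eta> n > 0"
    and "\<eta> \<longlonglongrightarrow> 0"
    and "0 \<le> e"
    and "(\<lambda>n. sqrt (real n) * \<eta> n) \<longlonglongrightarrow> e"
    and "(\<lambda>n. ereal (sqrt (real n) * \<theta> n)) \<longlonglongrightarrow> \<nu>"
  shows "weak_conv_m (\<lambda>n. F_H (\<eta> n) n (\<theta> n)) (hard_limit \<nu> e)
    \<and> (\<bar>\<nu>\<bar> = \<infinity> \<or> e = 0 \<longrightarrow> hard_limit \<nu> e = std_normal_distribution)"
proof
  let ?N = std_normal_distribution
  let ?g = "\<lambda>n. threshold_map (sqrt (real n) * \<eta> n) (ereal (sqrt (real n) * \<theta> n))"
  interpret N: real_distribution ?N by (rule real_dist_normal_dist)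
  show "weak_conv_m (\<lambda>n. F_H (\<eta> n) n (\<theta> n)) (hard_limit \<nu> e)"
  proof (rule integral_bdd_continuous_conv_imp_weak_conv)
    fix f :: "real \<Rightarrow> real"
    assume cont: "\<And>x. isCont f x" and bdd: "\<And>x. \<bar>f x\<bar> \<le> 1"
    have [measurable]: "f \<in> borel_measurable borel"
      by (intro borel_measurable_continuous_onI continuous_at_imp_continuous_on ballI cont)
    have "(\<lambda>n. \<integral>z. f (?g n z) \<partial>?N) \<longlonglongrightarrow> (\<integral>z. f (threshold_map e \<nu> z) \<partial>?N)"
    proof (rule integral_dominated_convergence[where w = "\<lambda>_. 1"])
      show "AE z in ?N. (\<lambda>n. f (?g n z)) \<longlonglongrightarrow> f (threshold_map e \<nu> z)"
        using AE_threshold_boundary[of \<nu> e]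
        by eventually_elim (intro isCont_tendsto_compose[OF cont] tendsto_threshold_map assms)
    qed (use bdd in auto)
    \<comment> \<open>The representation by the threshold map is available for
      \<open>n \<ge> 1\<close>, which suffices for the limit.\<close>
    moreover have "\<forall>\<^sub>F n in sequentially. (\<integral>z. f (?g n z) \<partial>?N)
        = integral\<^sup>L (F_H (\<eta> n) n (\<theta> n)) f"
      using eventually_ge_at_top[of 1]
      by eventually_elim (simp add: F_H_eq_distr_threshold_map integral_distr)
    ultimately show "(\<lambda>n. integral\<^sup>L (F_H (\<eta> n) n (\<theta> n)) f) \<longlonglongrightarrow> integral\<^sup>L (hard_limit \<nu> e) f"
      using \<open>0 \<le> e\<close>
      by (auto simp: hard_limit_eq_distr_threshold_map integral_distr
          intro: Lim_transform_eventually)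
  qed (use \<open>0 \<le> e\<close> in \<open>auto intro: real_distribution_F_H real_distribution_hard_limit\<close>)
  show "\<bar>\<nu>\<bar> = \<infinity> \<or> e = 0 \<longrightarrow> hard_limit \<nu> e = ?N"
  proof
    assume "\<bar>\<nu>\<bar> = \<infinity> \<or> e = 0"
    \<comment> \<open>If \<open>e = 0\<close> and \<open>\<nu>\<close> is finite, the second branch
      occurs only at \<open>z = - \<nu>\<close>, where its value is again \<open>z\<close>.\<close>
    then have "threshold_map e \<nu> = (\<lambda>z. z)"
      by (cases \<nu>) (auto simp: threshold_map_def fun_eq_iff)
    then show "hard_limit \<nu> e = ?N"
      using \<open>0 \<le> e\<close> by (simp add: hard_limit_eq_distr_threshold_map distr_id2)
  qed
qed

end
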